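(* Suppose the sequence of statistical models $\{P_{n,\theta}\}$ satisfies the following assumption (Assumption A): for any $\varepsilon>0$ and any $\theta\in\Theta$ there exist a positive integer $N$ and a neighborhood $O\subseteq\Theta$ of $\theta$ such that, for all $n\ge N$ and all $\theta_1,\theta_2\in O$, $$\pi(P_{n,\theta_1},P_{n,\theta_2})\ \ge\ \Phi\left(-\frac{|\theta_2-\theta_1|\sqrt{nI(\theta)}}{2}\right)-\varepsilon .$$ If $c>0$ and $T=\{T_n\}$ is an estimator for $\{P_{n,\theta}\}$, then the inequality $$\limsup_{n\to\infty}P_{n,\theta}\left(|T_n-\theta|>cn^{-1/2}\right)<\Phi\left(-c\sqrt{I(\theta)}\right)$$ holds for at most countably many $\theta\in\Theta$. In particular, $\mathrm{ae}_\theta(T)>1$ for at most countably many $\theta\in\Theta$. In particular, if for all $\theta\in\Theta$ the distribution of $(T_n-\theta)n^{1/2}$ under $P_{n,\theta}$ weakly converges to $N(0,v(\theta))$ as $n\to\infty$, then $v(\theta)<1/I(\theta)$ holds for at most countably many $\theta\in\Theta$.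
   Context: Setting: $\Omega_1,\Omega_2,\ldots$ is a sequence of measurable spaces; $\Theta$ is an open interval of the real line (possibly $\Theta=\mathbb{R}$); for each $n\in\{1,2,\ldots\}$, $\{P_{n,\theta}\mid\theta\in\Theta\}$ is a family of probability measures on $\Omega_n$. An estimator $T=\{T_n\}_{n=1}^\infty$ for $\{P_{n,\theta}\}$ is a sequence of measurable functions $T_n:\Omega_n\to\Theta$. $I:\Theta\to(0,\infty)$ is a fixed continuous function. $\Phi$ is the distribution function of the standard normal distribution. $N(\mu,\sigma^2)$ is the normal distribution with expectation $\mu$ and variance $\sigma^2\ge0$ (a point mass at $\mu$ if $\sigma^2=0$). Affinity: for probability measures $P,Q$ on the same measurable space $\Omega$, $\pi(P,Q):=\inf_E\max(P(E),Q(\Omega\setminus E))$, with $E$ ranging over the measurable sets in $\Omega$. Asymptotic efficiency of an estimator $T=\{T_n\}$ at $\theta\in\Theta$: $$\mathrm{ae}_\theta(T):=\liminf_{c\to\infty}\liminf_{n\to\infty}\frac{-\ln P_{n,\theta}(|T_n-\theta|>cn^{-1/2})}{c^2I(\theta)/2},$$ with the convention $-\ln 0:=\infty$. *)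

theory Defs
  imports "HOL-Probability.Probability"
begin

abbreviation std_normal_cdf :: "real \<Rightarrow> real" where
  "std_normal_cdf \<equiv> cdf std_normal_distribution"

text \<open>The second parameter of \<open>normal_dist\<close> is the variance (the library's
  \<^const>\<open>normal_density\<close> takes the standard deviation), with a point mass for variance 0.\<close>

definition normal_dist :: "real \<Rightarrow> real \<Rightarrow> real measure" where
  "normal_dist \<mu> v =
     (if v = 0 then return borel \<mu> else density lborel (normal_density \<mu> (sqrt v)))"

definition affinity :: "'a measure \<Rightarrow> 'a measure \<Rightarrow> real" where
  "affinity P Q = (INF E\<in>sets P. max (measure P E) (measure Q (space P - E)))"

text \<open>Only the underlying measurable space of \<open>\<Omega> n\<close> (its \<^const>\<open>space\<close> and
  \<^const>\<open>sets\<close>) matters. Indices start at 1, so the value at \<open>n = 0\<close> is unconstrained.\<close>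

definition statistical_models ::
  "real set \<Rightarrow> (nat \<Rightarrow> 'a measure) \<Rightarrow> (nat \<Rightarrow> real \<Rightarrow> 'a measure) \<Rightarrow> bool" where
  "statistical_models \<Theta> \<Omega> P \<longleftrightarrow>
     (\<forall>n\<ge>1. \<forall>\<theta>\<in>\<Theta>. prob_space (P n \<theta>) \<and> sets (P n \<theta>) = sets (\<Omega> n))"

definition estimator ::
  "real set \<Rightarrow> (nat \<Rightarrow> 'a measure) \<Rightarrow> (nat \<Rightarrow> 'a \<Rightarrow> real) \<Rightarrow> bool" where
  "estimator \<Theta> \<Omega> T \<longleftrightarrow> (\<forall>n\<ge>1. T n \<in> \<Omega> n \<rightarrow>\<^sub>M restrict_space borel \<Theta>)"

definition affinity_assumption ::
  "real set \<Rightarrow> (real \<Rightarrow> real) \<Rightarrow> (nat \<Rightarrow> real \<Rightarrow> 'a measure) \<Rightarrow> bool" where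
  "affinity_assumption \<Theta> I P \<longleftrightarrow>
     (\<forall>\<epsilon>>0. \<forall>\<theta>\<in>\<Theta>. \<exists>N\<ge>1. \<exists>U\<subseteq>\<Theta>. \<theta> \<in> interior U \<and>
        (\<forall>n\<ge>N. \<forall>\<theta>1\<in>U. \<forall>\<theta>2\<in>U.
           affinity (P n \<theta>1) (P n \<theta>2)
             \<ge> std_normal_cdf (- (\<bar>\<theta>2 - \<theta>1\<bar> * sqrt (real n * I \<theta>) / 2)) - \<epsilon>))"

definition deviation_prob ::
  "(nat \<Rightarrow> real \<Rightarrow> 'a measure) \<Rightarrow> (nat \<Rightarrow> 'a \<Rightarrow> real) \<Rightarrow> real \<Rightarrow> real \<Rightarrow> nat \<Rightarrow> real" where
  "deviation_prob P T \<theta> c n =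
     measure (P n \<theta>) {\<omega> \<in> space (P n \<theta>). \<bar>T n \<omega> - \<theta>\<bar> > c * real n powr (- 1 / 2)}"

definition neg_ln :: "real \<Rightarrow> ereal" where
  "neg_ln p = (if p = 0 then \<infinity> else ereal (- ln p))"

definition asymp_efficiency ::
  "(real \<Rightarrow> real) \<Rightarrow> (nat \<Rightarrow> real \<Rightarrow> 'a measure) \<Rightarrow> (nat \<Rightarrow> 'a \<Rightarrow> real) \<Rightarrow> real \<Rightarrow> ereal" where
  "asymp_efficiency I P T \<theta> =
     Liminf at_top (\<lambda>c::real.
       liminf (\<lambda>n. neg_ln (deviation_prob P T \<theta> c n) / ereal (c\<^sup>2 * I \<theta> / 2)))"

end

theory Submission
  imports Defs "HOL-Real_Asymp.Real_Asymp"
begin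

text \<open>
  An estimator that beats the bound \<open>\<Phi>(-c\<surd>I(\<theta>))\<close> at two parameters \<open>\<theta>\<^sub>1, \<theta>\<^sub>2\<close> yields too good a test
  between them. If \<open>n\<close> is such that \<open>|\<theta>\<^sub>2 - \<theta>\<^sub>1|\<close> just exceeds \<open>2c/\<surd>n\<close>, then \<open>T\<^sub>n\<close> cannot be within
  \<open>c/\<surd>n\<close> of both parameters, so rejecting \<open>\<theta>\<^sub>1\<close> when \<open>|T\<^sub>n - \<theta>\<^sub>1| > c/\<surd>n\<close> is a test whose two error
  probabilities are bounded by the deviation probabilities at \<open>\<theta>\<^sub>1\<close> and \<open>\<theta>\<^sub>2\<close>
  (\<open>affinity_le_deviation_prob\<close>). The assumption on the models bounds the affinity, and hence the
  larger of the two errors, from below by nearly \<open>\<Phi>(-c\<surd>I)\<close>, because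
  \<open>|\<theta>\<^sub>2 - \<theta>\<^sub>1|\<surd>n/2\<close> is nearly \<open>c\<close>.

  Each exceptional parameter beats the bound by some margin \<open>1/(m+1)\<close> from some sample size \<open>M\<close> on,
  so the exceptional set is a countable union of sets on which \<open>M\<close> and \<open>m\<close> are uniform. If a
  parameter \<open>t\<close> in such a set were a limit point of the set, then pairing \<open>t\<close> with parameters
  \<open>x\<^sub>k \<rightarrow> t\<close> of the set, and choosing \<open>n\<^sub>k\<close> as above, would contradict the lower bound in the limit
  (\<open>uniform_gap_no_limit_point\<close>). A set of reals without limit points of its own is countable.

  The other two claims reduce to the first one for integer \<open>c\<close>, by comparing Gaussian tails. If the
  efficiency at \<open>\<theta>\<close> exceeds \<open>1\<close>, or the limiting variance is below \<open>1/I(\<theta>)\<close>, then for some \<open>K > 1\<close>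
  and all large \<open>c\<close> the upper limit of the deviation probabilities is at most
  \<open>2 exp(-K c\<^sup>2 I(\<theta>)/2)\<close>. For large \<open>c\<close> this is smaller than \<open>\<Phi>(-c\<surd>I(\<theta>))\<close>, whose exponential rate is
  exactly \<open>c\<^sup>2 I(\<theta>)/2\<close> (\<open>eventually_exp_less_std_normal_cdf\<close>). The factor \<open>2\<close> for the two tails is
  harmless because \<open>K > 1\<close>.
\<close>

section \<open>Sets without limit points of their own\<close>

text \<open>Second countability: every point is the only point of the set in some basic open set, and
  there are only countably many of those.\<close>

lemma countable_if_no_limit_point:
  fixes S :: "'b::second_countable_topology set"
  assumes "\<And>x. x \<in> S \<Longrightarrow> \<not> x islimpt S"
  shows "countable S"
proof -
  obtain B :: "'b set set" where B: "countable B" "topological_basis B"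
    using ex_countable_basis by blast
  have "\<exists>b\<in>B. b \<inter> S = {x}" if "x \<in> S" for x
  proof -
    have "\<not> x islimpt S" using assms that .
    then obtain U where U: "x \<in> U" "open U" "\<forall>y\<in>S. y \<in> U \<longrightarrow> y = x"
      unfolding islimpt_def by blast
    obtain b where "b \<in> B" "x \<in> b" "b \<subseteq> U"
      using topological_basisE[OF B(2) U(2,1)] by metis
    with U(3) that show ?thesis by blast
  qed
  then obtain b where b: "\<And>x. x \<in> S \<Longrightarrow> b x \<in> B \<and> b x \<inter> S = {x}" by metis
  have "inj_on b S"
    by (rule inj_onI) (metis b singleton_inject)
  moreover have "b ` S \<subseteq> B" using b by blast
  ultimately show ?thesis
    using B(1) countable_image_inj_on countable_subset by blast
qed

section \<open>Testing two parameters with an estimator\<close>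

lemma affinity_le:
  assumes "E \<in> sets P"
  shows "affinity P Q \<le> max (measure P E) (measure Q (space P - E))"
  unfolding affinity_def
  by (rule cINF_lower[OF _ assms]) (auto intro!: bdd_belowI2[where m = 0] simp: le_max_iff_disj)

lemma deviation_event_measurable:
  assumes "statistical_models \<Theta> \<Omega> P" "estimator \<Theta> \<Omega> T" "\<theta> \<in> \<Theta>" "n \<ge> 1"
  shows "T n \<in> borel_measurable (P n \<theta>)"
    and "{\<omega> \<in> space (P n \<theta>). \<bar>T n \<omega> - t\<bar> > c} \<in> sets (P n \<theta>)"
proof -
  have "T n \<in> \<Omega> n \<rightarrow>\<^sub>M restrict_space borel \<Theta>" "sets (P n \<theta>) = sets (\<Omega> n)"
    using assms by (auto simp: estimator_def statistical_models_def)
  then have "T n \<in> P n \<theta> \<rightarrow>\<^sub>M restrict_space borel \<Theta>"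
    by (simp cong: measurable_cong_sets)
  then show [measurable]: "T n \<in> borel_measurable (P n \<theta>)"
    by (rule measurable_restrict_space2_iff[THEN iffD1, THEN conjunct1])
  show "{\<omega> \<in> space (P n \<theta>). \<bar>T n \<omega> - t\<bar> > c} \<in> sets (P n \<theta>)"
    by measurable
qed

text \<open>The test rejects \<open>\<theta>\<^sub>1\<close> when \<open>T\<^sub>n\<close> deviates from it. By the separation of the parameters, its
  error under \<open>\<theta>\<^sub>2\<close> forces a deviation of \<open>T\<^sub>n\<close> from \<open>\<theta>\<^sub>2\<close>.\<close>

lemma affinity_le_deviation_prob:
  assumes SM: "statistical_models \<Theta> \<Omega> P" and est: "estimator \<Theta> \<Omega> T"
    and \<theta>: "\<theta>1 \<in> \<Theta>" "\<theta>2 \<in> \<Theta>" and n: "n \<ge> 1"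
    and sep: "2 * c < \<bar>\<theta>2 - \<theta>1\<bar> * sqrt (real n)"
  shows "affinity (P n \<theta>1) (P n \<theta>2) \<le> max (deviation_prob P T \<theta>1 c n) (deviation_prob P T \<theta>2 c n)"
proof -
  define r where "r = c * real n powr (- 1 / 2)"
  define D where "D \<theta> = {\<omega> \<in> space (P n \<theta>). \<bar>T n \<omega> - \<theta>\<bar> > r}" for \<theta>
  have powr: "real n powr (- 1 / 2) = 1 / sqrt (real n)"
    using powr_minus_divide[of "real n" "1 / 2"] by (simp add: powr_half_sqrt)
  with sep n have r: "2 * r < \<bar>\<theta>2 - \<theta>1\<bar>"
    unfolding r_def powr by (simp add: field_simps)
  have D: "D \<theta> \<in> sets (P n \<theta>)" if "\<theta> \<in> \<Theta>" for \<theta>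
    unfolding D_def using deviation_event_measurable(2)[OF SM est that n] .
  interpret P2: prob_space "P n \<theta>2"
    using SM \<theta>(2) n by (simp add: statistical_models_def)
  have "sets (P n \<theta>1) = sets (P n \<theta>2)"
    using SM \<theta> n by (simp add: statistical_models_def)
  then have sp: "space (P n \<theta>1) = space (P n \<theta>2)"
    by (rule sets_eq_imp_space_eq)
  have "space (P n \<theta>1) - D \<theta>1 \<subseteq> D \<theta>2"
    using r by (auto simp: D_def sp)
  then have "measure (P n \<theta>2) (space (P n \<theta>1) - D \<theta>1) \<le> measure (P n \<theta>2) (D \<theta>2)"
    by (rule P2.finite_measure_mono[OF _ D[OF \<theta>(2)]])
  then show ?thesis
    using affinity_le[OF D[OF \<theta>(1)], of "P n \<theta>2"]
    by (simp add: deviation_prob_def D_def r_def)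
qed

section \<open>The exceptional set for a fixed radius\<close>

text \<open>The strict inequality provides the separation that the test requires; the limit says that
  no more of it is spent than necessary.\<close>

lemma sample_sizes_matching_distances:
  fixes d :: "nat \<Rightarrow> real"
  assumes c: "c > 0" and d: "\<And>k. d k > 0" and d0: "d \<longlonglongrightarrow> 0"
  obtains n :: "nat \<Rightarrow> nat" where "filterlim n at_top sequentially"
    "\<And>k. 2 * c < d k * sqrt (real (n k))"
    "(\<lambda>k. d k * sqrt (real (n k))) \<longlonglongrightarrow> 2 * c"
proof
  \<comment> \<open>The least sample size with \<open>\<surd>n d\<^sub>k > 2c\<close>; it overshoots \<open>(2c/d\<^sub>k)\<^sup>2\<close> by at most \<open>1\<close>, which
    contributes only \<open>d\<^sub>k\<^sup>2 \<rightarrow> 0\<close> to the square of the product.\<close>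
  let ?n = "\<lambda>k. nat \<lfloor>(2 * c / d k)\<^sup>2\<rfloor> + 1"
  have lo: "(2 * c / d k)\<^sup>2 < real (?n k)" and hi: "real (?n k) \<le> (2 * c / d k)\<^sup>2 + 1" for k
    by linarith (simp add: of_nat_nat)
  have sep: "2 * c < d k * sqrt (real (?n k))" for k
  proof -
    have "2 * c / d k < sqrt (real (?n k))"
      using lo[of k] real_less_rsqrt by blast
    then show ?thesis using d[of k] by (simp add: field_simps)
  qed
  then show "\<And>k. 2 * c < d k * sqrt (real (?n k))" .
  have up: "d k * sqrt (real (?n k)) \<le> sqrt (4 * c\<^sup>2 + (d k)\<^sup>2)" for k
  proof (rule real_le_rsqrt)
    have "(d k * sqrt (real (?n k)))\<^sup>2 = (d k)\<^sup>2 * real (?n k)"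
      by (simp add: power_mult_distrib)
    also have "\<dots> \<le> (d k)\<^sup>2 * ((2 * c / d k)\<^sup>2 + 1)"
      by (rule mult_left_mono[OF hi]) simp
    also have "\<dots> = 4 * c\<^sup>2 + (d k)\<^sup>2"
      using d[of k] by (simp add: field_simps)
    finally show "(d k * sqrt (real (?n k)))\<^sup>2 \<le> 4 * c\<^sup>2 + (d k)\<^sup>2" .
  qed
  have "(\<lambda>k. sqrt (4 * c\<^sup>2 + (d k)\<^sup>2)) \<longlonglongrightarrow> sqrt (4 * c\<^sup>2 + 0\<^sup>2)"
    by (intro tendsto_intros d0)
  also have "sqrt (4 * c\<^sup>2 + 0\<^sup>2) = 2 * c"
    using c by (simp add: real_sqrt_mult)
  finally have lim: "(\<lambda>k. sqrt (4 * c\<^sup>2 + (d k)\<^sup>2)) \<longlonglongrightarrow> 2 * c" .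
  show "(\<lambda>k. d k * sqrt (real (?n k))) \<longlonglongrightarrow> 2 * c"
    by (rule tendsto_sandwich[OF _ _ tendsto_const lim]) (use sep up in \<open>auto intro!: always_eventually less_imp_le\<close>)
  have "filterlim d (at_right 0) sequentially"
    using d0 d by (simp add: filterlim_at less_imp_neq[symmetric])
  then have "filterlim (\<lambda>k. (2 * c) * inverse (d k)) at_top sequentially"
    using c by (intro filterlim_tendsto_pos_mult_at_top[OF tendsto_const] 
      filterlim_compose[OF filterlim_inverse_at_top_right]) auto
  then have "filterlim (\<lambda>k. (2 * c / d k)\<^sup>2) at_top sequentially"
    by (intro filterlim_pow_at_top) (auto simp: divide_inverse)
  then have "filterlim (\<lambda>k. real (?n k)) at_top sequentially"
    by (rule filterlim_at_top_mono) (use lo in \<open>auto intro!: always_eventually less_imp_le simp del: of_nat_Suc of_nat_add\<close>)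
  then show "filterlim ?n at_top sequentially"
    using filterlim_sequentially_iff_filterlim_real by blast
qed

lemma isCont_cdf_density:
  fixes f :: "real \<Rightarrow> real"
  assumes "prob_space (density lborel f)" and [measurable]: "f \<in> borel_measurable borel"
  shows "isCont (cdf (density lborel f)) x"
proof -
  interpret prob_space "density lborel f" by fact
  interpret real_distribution "density lborel f"
    by unfold_locales simp_all
  have "emeasure (density lborel f) {x} = 0"
    by (simp add: emeasure_density nn_integral_indicator_singleton)
  then show ?thesis
    by (simp add: isCont_cdf measure_def)
qed

text \<open>Along a sequence in \<open>S\<close> tending to \<open>t\<close>, with matching sample sizes, the test has limiting error
  at most \<open>\<Phi>(-c\<surd>I(t)) - \<epsilon>\<close>, by continuity of \<open>I\<close>, whereas the affinity assumption at \<open>t\<close> with error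
  \<open>\<epsilon>/2\<close> forces at least \<open>\<Phi>(-c\<surd>I(t)) - \<epsilon>/2\<close>.\<close>

lemma uniform_gap_no_limit_point:
  assumes op: "open \<Theta>" and cI: "continuous_on \<Theta> I"
    and SM: "statistical_models \<Theta> \<Omega> P" and aff: "affinity_assumption \<Theta> I P"
    and est: "estimator \<Theta> \<Omega> T" and c: "c > 0" and \<epsilon>: "\<epsilon> > 0"
    and S: "S \<subseteq> \<Theta>"
    and gap: "\<And>\<theta> n. \<theta> \<in> S \<Longrightarrow> n \<ge> M \<Longrightarrow>
      deviation_prob P T \<theta> c n \<le> std_normal_cdf (- c * sqrt (I \<theta>)) - \<epsilon>"
    and t: "t \<in> S"
  shows "\<not> t islimpt S"
proof
  assume "t islimpt S"
  then obtain x where x: "\<And>k. x k \<in> S - {t}" and xt: "x \<longlonglongrightarrow> t"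
    unfolding islimpt_sequential by blast
  define d where "d k = \<bar>t - x k\<bar>" for k
  have d: "d k > 0" for k using x[of k] by (auto simp: d_def)
  have "d \<longlonglongrightarrow> \<bar>t - t\<bar>" unfolding d_def by (intro tendsto_intros xt)
  then have d0: "d \<longlonglongrightarrow> 0" by simp
  obtain n where n_top: "filterlim n at_top sequentially"
    and sep: "\<And>k. 2 * c < d k * sqrt (real (n k))"
    and n_lim: "(\<lambda>k. d k * sqrt (real (n k))) \<longlonglongrightarrow> 2 * c"
    using sample_sizes_matching_distances[OF c d d0] by blast
  have t\<Theta>: "t \<in> \<Theta>" using t S by blast
  have "\<epsilon> / 2 > 0" using \<epsilon> by simp
  then obtain N :: nat and U where N: "N \<ge> 1" and U: "t \<in> interior U"
    and lower: "\<And>n \<theta>1 \<theta>2. n \<ge> N \<Longrightarrow> \<theta>1 \<in> U \<Longrightarrow> \<theta>2 \<in> U \<Longrightarrow>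
      affinity (P n \<theta>1) (P n \<theta>2)
        \<ge> std_normal_cdf (- (\<bar>\<theta>2 - \<theta>1\<bar> * sqrt (real n * I t) / 2)) - \<epsilon> / 2"
    using aff t\<Theta> unfolding affinity_assumption_def by meson
  let ?\<Phi> = std_normal_cdf
  have "eventually (\<lambda>k. x k \<in> interior U) sequentially"
    using topological_tendstoD[OF xt open_interior U] .
  then have evU: "eventually (\<lambda>k. x k \<in> U) sequentially"
    by eventually_elim (use interior_subset in blast)
  have evN: "eventually (\<lambda>k. n k \<ge> max N M) sequentially"
    using n_top unfolding filterlim_at_top by blast
  have ineq: "eventually (\<lambda>k. ?\<Phi> (- (d k * sqrt (real (n k)) * sqrt (I t) / 2)) - \<epsilon> / 2
      \<le> max (?\<Phi> (- c * sqrt (I (x k)))) (?\<Phi> (- c * sqrt (I t))) - \<epsilon>) sequentially"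
    using evU evN
  proof eventually_elim
    case (elim k)
    have "?\<Phi> (- (d k * sqrt (real (n k)) * sqrt (I t) / 2)) - \<epsilon> / 2
        \<le> affinity (P (n k) (x k)) (P (n k) t)"
      using lower[of "n k" "x k" t] elim U interior_subset[of U]
      by (auto simp: d_def real_sqrt_mult mult.assoc)
    also have "\<dots> \<le> max (deviation_prob P T (x k) c (n k)) (deviation_prob P T t c (n k))"
      using x[of k] S t\<Theta> elim N sep[of k]
      by (intro affinity_le_deviation_prob[OF SM est]) (auto simp: d_def)
    also have "\<dots> \<le> max (?\<Phi> (- c * sqrt (I (x k))) - \<epsilon>) (?\<Phi> (- c * sqrt (I t)) - \<epsilon>)"
      using x[of k] t elim by (intro max.mono gap) auto
    finally show ?case by linarith
  qed
  have cont: "isCont ?\<Phi> y" for y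
    by (rule isCont_cdf_density) (use prob_space_normal_density[of 1 0] in auto)
  have "isCont I t"
    using cI op t\<Theta> continuous_on_eq_continuous_at by blast
  then have Ix: "(\<lambda>k. I (x k)) \<longlonglongrightarrow> I t"
    using xt by (rule isCont_tendsto_compose)
  have "(\<lambda>k. - (d k * sqrt (real (n k)) * sqrt (I t) / 2)) \<longlonglongrightarrow> - (2 * c * sqrt (I t) / 2)"
    by (intro tendsto_intros n_lim) auto
  then have L: "(\<lambda>k. ?\<Phi> (- (d k * sqrt (real (n k)) * sqrt (I t) / 2)) - \<epsilon> / 2)
      \<longlonglongrightarrow> ?\<Phi> (- (2 * c * sqrt (I t) / 2)) - \<epsilon> / 2"
    by (intro tendsto_diff tendsto_const isCont_tendsto_compose[OF cont])
  have R: "(\<lambda>k. max (?\<Phi> (- c * sqrt (I (x k)))) (?\<Phi> (- c * sqrt (I t))) - \<epsilon>)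
      \<longlonglongrightarrow> max (?\<Phi> (- c * sqrt (I t))) (?\<Phi> (- c * sqrt (I t))) - \<epsilon>"
    by (intro tendsto_diff tendsto_max tendsto_const isCont_tendsto_compose[OF cont] tendsto_intros Ix)
  have "?\<Phi> (- (2 * c * sqrt (I t) / 2)) - \<epsilon> / 2
      \<le> max (?\<Phi> (- c * sqrt (I t))) (?\<Phi> (- c * sqrt (I t))) - \<epsilon>"
    by (rule tendsto_le[OF _ R L ineq]) simp
  with \<epsilon> show False by simp
qed

text \<open>Sorting the exceptional parameters by a margin \<open>1/(m+1)\<close> and an initial sample size \<open>M\<close> gives
  countably many classes, on each of which both are uniform.\<close>

proposition countable_small_deviation_prob:
  assumes "open \<Theta>" "continuous_on \<Theta> I"
    and "statistical_models \<Theta> \<Omega> P" "affinity_assumption \<Theta> I P"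
    and "estimator \<Theta> \<Omega> T" "c > 0"
  shows "countable {\<theta>\<in>\<Theta>. limsup (\<lambda>n. ereal (deviation_prob P T \<theta> c n))
              < ereal (std_normal_cdf (- c * sqrt (I \<theta>)))}" (is "countable ?A")
proof -
  define S where "S M m = {\<theta>\<in>\<Theta>. \<forall>n\<ge>M. deviation_prob P T \<theta> c n
      \<le> std_normal_cdf (- c * sqrt (I \<theta>)) - 1 / real (Suc m)}" for M m :: nat
  have "countable (S M m)" for M m
  proof (rule countable_if_no_limit_point)
    fix t assume "t \<in> S M m"
    then show "\<not> t islimpt S M m"
      by (rule uniform_gap_no_limit_point[OF assms, where \<epsilon> = "1 / real (Suc m)" and M = M, rotated -1])
         (auto simp: S_def)
  qed
  moreover have "?A \<subseteq> (\<Union>M m. S M m)"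
  proof
    fix t assume "t \<in> ?A"
    then have t: "t \<in> \<Theta>" and lt: "limsup (\<lambda>n. ereal (deviation_prob P T t c n))
              < ereal (std_normal_cdf (- c * sqrt (I t)))" by auto
    obtain r where r: "limsup (\<lambda>n. ereal (deviation_prob P T t c n)) < ereal r"
      "ereal r < ereal (std_normal_cdf (- c * sqrt (I t)))"
      using ereal_dense2[OF lt] by blast
    have "eventually (\<lambda>n. ereal (deviation_prob P T t c n) < ereal r) sequentially"
      by (rule Limsup_lessD[OF r(1)])
    then obtain M where M: "\<And>n. n \<ge> M \<Longrightarrow> deviation_prob P T t c n < r"
      by (auto simp: eventually_sequentially)
    have "std_normal_cdf (- c * sqrt (I t)) - r > 0" using r(2) by simp
    then obtain m where "1 / real (Suc m) < std_normal_cdf (- c * sqrt (I t)) - r"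
      using nat_approx_posE by blast
    then have "t \<in> S M m" using t M by (fastforce simp: S_def)
    then show "t \<in> (\<Union>M m. S M m)" by blast
  qed
  ultimately show ?thesis
    by (meson countable_UN countable_subset uncountable_def countableI_type)
qed

section \<open>Gaussian tails\<close>

text \<open>The interval of length \<open>1\<close> to the left of \<open>-x\<close> already carries this mass, as the density is
  smallest at its left end \<open>-(x + 1)\<close>. The loss against the true tail is negligible on the
  exponential scale \<open>x\<^sup>2\<close>.\<close>

lemma std_normal_cdf_lower_bound:
  assumes "x \<ge> 0"
  shows "std_normal_cdf (- x) \<ge> exp (- (x + 1)\<^sup>2 / 2) / sqrt (2 * pi)"
proof -
  let ?m = "exp (- (x + 1)\<^sup>2 / 2) / sqrt (2 * pi)"
  let ?J = "{- x - 1..- x}"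
  interpret prob_space std_normal_distribution
    by (rule prob_space_normal_density) simp
  have "ennreal ?m = ennreal ?m * emeasure lborel ?J"
    by simp
  also have "\<dots> = (\<integral>\<^sup>+y. ennreal ?m * indicator ?J y \<partial>lborel)"
    by (simp add: nn_integral_cmult_indicator)
  also have "\<dots> \<le> (\<integral>\<^sup>+y. ennreal (std_normal_density y) * indicator ?J y \<partial>lborel)"
  proof (rule nn_integral_mono)
    fix y
    have "?m \<le> std_normal_density y" if "y \<in> ?J"
    proof -
      have "y\<^sup>2 \<le> (x + 1)\<^sup>2" using that assms by (intro abs_le_square_iff[THEN iffD1]) auto
      then show ?thesis by (simp add: std_normal_density_def divide_right_mono)
    qed
    then show "ennreal ?m * indicator ?J y \<le> ennreal (std_normal_density y) * indicator ?J y"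
      by (auto simp: indicator_def intro!: ennreal_leI)
  qed
  also have "\<dots> = emeasure std_normal_distribution ?J"
    by (simp add: emeasure_density)
  finally have "?m \<le> measure std_normal_distribution ?J"
    by (simp add: emeasure_eq_measure)
  also have "\<dots> \<le> std_normal_cdf (- x)"
    unfolding cdf_def by (intro finite_measure_mono) auto
  finally show ?thesis .
qed

lemma eventually_exp_less_std_normal_cdf:
  assumes K: "K > 1" and s: "s > 0"
  shows "eventually (\<lambda>c::real. 2 * exp (- (K * c\<^sup>2 * s / 2)) < std_normal_cdf (- c * sqrt s)) at_top"
proof -
  have sq: "sqrt s > 0" using s by simp
  have "eventually (\<lambda>x::real. 2 * exp (- (K * x\<^sup>2 / 2)) < exp (- (x + 1)\<^sup>2 / 2) / sqrt (2 * pi)) at_top"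
    using K by real_asymp
  then have "eventually (\<lambda>x::real. 2 * exp (- (K * x\<^sup>2 / 2)) < std_normal_cdf (- x)) at_top"
    using eventually_ge_at_top[of 0]
    by eventually_elim (use std_normal_cdf_lower_bound order_less_le_trans in blast)
  moreover have "filterlim (\<lambda>c::real. c * sqrt s) at_top at_top"
    using sq by real_asymp
  ultimately have "eventually (\<lambda>c::real. 2 * exp (- (K * (c * sqrt s)\<^sup>2 / 2)) < std_normal_cdf (- (c * sqrt s))) at_top"
    by (rule eventually_compose_filterlim)
  then show ?thesis
    using s by (simp add: power_mult_distrib mult.assoc)
qed

text \<open>Where \<open>a x \<ge> a\<^sup>2\<close>, one has \<open>x\<^sup>2 \<ge> a\<^sup>2 + (x - a)\<^sup>2\<close>, so the centred density is at most
  \<open>exp(-a\<^sup>2/(2\<sigma>\<^sup>2))\<close> times the density centred at \<open>a\<close>, whose total mass is \<open>1\<close>. The sign of \<open>a\<close>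
  selects the upper or the lower tail.\<close>

lemma measure_normal_density_tail:
  assumes \<sigma>: "\<sigma> > 0" and J: "J \<in> sets borel" and tail: "\<And>x. x \<in> J \<Longrightarrow> a\<^sup>2 \<le> a * x"
  shows "measure (density lborel (normal_density 0 \<sigma>)) J \<le> exp (- (a\<^sup>2 / (2 * \<sigma>\<^sup>2)))"
proof -
  let ?e = "exp (- (a\<^sup>2 / (2 * \<sigma>\<^sup>2)))"
  interpret N: prob_space "density lborel (normal_density 0 \<sigma>)"
    using \<sigma> by (rule prob_space_normal_density)
  interpret Na: prob_space "density lborel (normal_density a \<sigma>)"
    using \<sigma> by (rule prob_space_normal_density)
  have "emeasure (density lborel (normal_density 0 \<sigma>)) J
      = (\<integral>\<^sup>+x. ennreal (normal_density 0 \<sigma> x) * indicator J x \<partial>lborel)"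
    using J by (simp add: emeasure_density)
  also have "\<dots> \<le> (\<integral>\<^sup>+x. ennreal ?e * (ennreal (normal_density a \<sigma> x) * indicator J x) \<partial>lborel)"
  proof (rule nn_integral_mono)
    fix x
    have "normal_density 0 \<sigma> x \<le> ?e * normal_density a \<sigma> x" if "x \<in> J"
    proof -
      have "- x\<^sup>2 \<le> - a\<^sup>2 - (x - a)\<^sup>2"
        using tail[OF that] by (simp add: power2_eq_square algebra_simps)
      then have "- x\<^sup>2 / (2 * \<sigma>\<^sup>2) \<le> (- a\<^sup>2 - (x - a)\<^sup>2) / (2 * \<sigma>\<^sup>2)"
        by (rule divide_right_mono) simp
      also have "\<dots> = - (a\<^sup>2 / (2 * \<sigma>\<^sup>2)) + - (x - a)\<^sup>2 / (2 * \<sigma>\<^sup>2)"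
        by (simp add: diff_divide_distrib)
      finally have "exp (- x\<^sup>2 / (2 * \<sigma>\<^sup>2)) \<le> ?e * exp (- (x - a)\<^sup>2 / (2 * \<sigma>\<^sup>2))"
        by (simp flip: exp_add)
      then show ?thesis
        by (simp add: normal_density_def divide_right_mono)
    qed
    then show "ennreal (normal_density 0 \<sigma> x) * indicator J x
        \<le> ennreal ?e * (ennreal (normal_density a \<sigma> x) * indicator J x)"
      by (auto simp: indicator_def simp flip: ennreal_mult intro!: ennreal_leI)
  qed
  also have "\<dots> = ennreal ?e * emeasure (density lborel (normal_density a \<sigma>)) J"
    using J by (simp add: emeasure_density nn_integral_cmult)
  also have "\<dots> \<le> ennreal ?e * 1"
    by (intro mult_left_mono Na.measure_le_1) simp
  finally show ?thesis
    by (simp add: N.emeasure_eq_measure)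
qed

text \<open>The bound is stated with a variance \<open>w > v\<close> so that it also covers the point mass \<open>v = 0\<close>,
  for which \<open>exp(-c\<^sup>2/(2v))\<close> would read \<open>1\<close>, because \<open>c\<^sup>2/0 = 0\<close>.\<close>

lemma normal_dist_tail_bound:
  assumes v: "0 \<le> v" and w: "v < w" and c: "c > 0"
  shows "isCont (cdf (normal_dist 0 v)) c" "isCont (cdf (normal_dist 0 v)) (- c)"
    "1 - cdf (normal_dist 0 v) c + cdf (normal_dist 0 v) (- c) \<le> 2 * exp (- (c\<^sup>2 / (2 * w)))"
proof (atomize (full), cases "v = 0")
  case True
  interpret prob_space "return borel (0::real)"
    by (rule prob_space_return) simp
  interpret real_distribution "return borel (0::real)"
    by unfold_locales simp_all
  have "cdf (return borel (0::real)) y = indicator {..y} 0" for y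
    unfolding cdf_def by (simp add: measure_return)
  moreover have "isCont (cdf (return borel (0::real))) y" if "y \<noteq> 0" for y
    using that by (simp add: isCont_cdf measure_return)
  ultimately show "isCont (cdf (normal_dist 0 v)) c \<and> isCont (cdf (normal_dist 0 v)) (- c) \<and>
    1 - cdf (normal_dist 0 v) c + cdf (normal_dist 0 v) (- c) \<le> 2 * exp (- (c\<^sup>2 / (2 * w)))"
    using c True by (simp add: normal_dist_def)
next
  case False
  with v have \<sigma>: "sqrt v > 0" and v0: "v > 0" by auto
  let ?M = "density lborel (normal_density 0 (sqrt v))"
  have M: "normal_dist 0 v = ?M" using False by (simp add: normal_dist_def)
  interpret prob_space ?M
    using \<sigma> by (rule prob_space_normal_density)
  have cont: "isCont (cdf ?M) y" for y
    by (rule isCont_cdf_density) (simp_all add: prob_space_axioms)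
  have "c\<^sup>2 / (2 * w) \<le> c\<^sup>2 / (2 * v)"
    using w v0 by (intro divide_left_mono) auto
  then have e: "exp (- (c\<^sup>2 / (2 * v))) \<le> exp (- (c\<^sup>2 / (2 * w)))" by simp
  have "1 - cdf ?M c = measure ?M {c<..}"
    using prob_compl[of "{..c}"] by (simp add: cdf_def Compl_eq_Diff_UNIV[symmetric])
  also have "\<dots> \<le> exp (- (c\<^sup>2 / (2 * (sqrt v)\<^sup>2)))"
    using c by (intro measure_normal_density_tail[OF \<sigma>]) (auto simp: power2_eq_square)
  finally have up: "1 - cdf ?M c \<le> exp (- (c\<^sup>2 / (2 * v)))" using v by simp
  have "(- c)\<^sup>2 \<le> - c * x" if "x \<le> - c" for x
    using mult_left_mono_neg[OF that, of "- c"] c by (simp add: power2_eq_square)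
  then have "cdf ?M (- c) \<le> exp (- ((- c)\<^sup>2 / (2 * (sqrt v)\<^sup>2)))"
    unfolding cdf_def by (intro measure_normal_density_tail[OF \<sigma>]) auto
  then have lo: "cdf ?M (- c) \<le> exp (- (c\<^sup>2 / (2 * v)))" using v by simp
  show "isCont (cdf (normal_dist 0 v)) c \<and> isCont (cdf (normal_dist 0 v)) (- c) \<and>
    1 - cdf (normal_dist 0 v) c + cdf (normal_dist 0 v) (- c) \<le> 2 * exp (- (c\<^sup>2 / (2 * w)))"
    unfolding M using cont up lo e by (intro conjI) (blast, blast, linarith)
qed

section \<open>Deviation probabilities under the two criteria\<close>

lemma limsup_deviation_prob_le_exp:
  assumes c: "c > 0" and s: "s > 0" 
    and lt: "liminf (\<lambda>n. neg_ln (deviation_prob P T \<theta> c n) / ereal (c\<^sup>2 * s / 2)) > ereal K"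
  shows "limsup (\<lambda>n. ereal (deviation_prob P T \<theta> c n)) \<le> ereal (exp (- (K * c\<^sup>2 * s / 2)))"
proof -
  have pos: "c\<^sup>2 * s / 2 > 0" using c s by simp
  have "eventually (\<lambda>n. ereal K < neg_ln (deviation_prob P T \<theta> c n) / ereal (c\<^sup>2 * s / 2)) sequentially"
    by (rule less_LiminfD[OF lt])
  then have "eventually (\<lambda>n. ereal (deviation_prob P T \<theta> c n) \<le> ereal (exp (- (K * c\<^sup>2 * s / 2)))) sequentially"
  proof eventually_elim
    case (elim n)
    let ?p = "deviation_prob P T \<theta> c n"
    show ?case
    proof (cases "?p = 0")
      case False
      then have p: "?p > 0" by (simp add: deviation_prob_def zero_less_measure_iff)
      have "K < - ln ?p / (c\<^sup>2 * s / 2)"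
        using elim False c s by (simp add: neg_ln_def)
      then have "K * (c\<^sup>2 * s / 2) < - ln ?p"
        using pos pos_less_divide_eq by blast
      then have "ln ?p \<le> - (K * c\<^sup>2 * s / 2)" by (simp add: mult.assoc)
      with p have "?p \<le> exp (- (K * c\<^sup>2 * s / 2))"
        by (metis exp_le_cancel_iff exp_ln)
      then show ?thesis by simp
    qed simp
  qed
  then show ?thesis by (rule Limsup_bounded)
qed

text \<open>The deviation event is \<open>|(T\<^sub>n - \<theta>)\<surd>n| > c\<close>, so its probability is at most
  \<open>1 - F\<^sub>n(c) + F\<^sub>n(-c)\<close> for the distribution function \<open>F\<^sub>n\<close> of the normalised error. The atom that
  \<open>F\<^sub>n\<close> may have at \<open>-c\<close> makes this an inequality.\<close>

lemma limsup_deviation_prob_le_weak_limit: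
  assumes SM: "statistical_models \<Theta> \<Omega> P" and est: "estimator \<Theta> \<Omega> T"
    and \<theta>: "\<theta> \<in> \<Theta>"
    and conv: "weak_conv_m
                 (\<lambda>n. distr (P n \<theta>) borel (\<lambda>\<omega>. (T n \<omega> - \<theta>) * real n powr (1 / 2))) M"
    and cont: "isCont (cdf M) c" "isCont (cdf M) (- c)"
  shows "limsup (\<lambda>n. ereal (deviation_prob P T \<theta> c n)) \<le> ereal (1 - cdf M c + cdf M (- c))"
proof -
  define X where "X n \<omega> = (T n \<omega> - \<theta>) * real n powr (1 / 2)" for n \<omega>
  define F where "F n = cdf (distr (P n \<theta>) borel (X n))" for n
  have F: "(\<lambda>n. F n y) \<longlonglongrightarrow> cdf M y" if "isCont (cdf M) y" for y
    using conv that unfolding weak_conv_m_def weak_conv_def F_def X_def by blast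
  have "(\<lambda>n. ereal (1 - F n c + F n (- c))) \<longlonglongrightarrow> ereal (1 - cdf M c + cdf M (- c))"
    by (intro tendsto_intros F cont)
  then have lim: "limsup (\<lambda>n. ereal (1 - F n c + F n (- c))) = ereal (1 - cdf M c + cdf M (- c))"
    by (rule lim_imp_Limsup[OF sequentially_bot])
  have le: "deviation_prob P T \<theta> c n \<le> 1 - F n c + F n (- c)" if n: "n \<ge> 1" for n
  proof -
    interpret prob_space "P n \<theta>"
      using SM \<theta> n by (simp add: statistical_models_def)
    note [measurable] = deviation_event_measurable(1)[OF SM est \<theta> n]
    have X[measurable]: "X n \<in> borel_measurable (P n \<theta>)"
      unfolding X_def by measurable
    have Fn: "F n y = prob {\<omega> \<in> space (P n \<theta>). X n \<omega> \<le> y}" for y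
      unfolding F_def cdf_def by (simp add: measure_distr vimage_def Int_def conj_commute)
    have iff: "\<bar>T n \<omega> - \<theta>\<bar> > c * real n powr (- 1 / 2) \<longleftrightarrow> \<bar>X n \<omega>\<bar> > c" for \<omega>
    proof -
      have powr: "real n powr (- 1 / 2) = 1 / real n powr (1 / 2)"
        using powr_minus_divide[of "real n" "1 / 2"] by simp
      moreover have "real n powr (1 / 2) > 0" using n by simp
      ultimately show ?thesis
        unfolding powr X_def by (simp add: abs_mult divide_simps)
    qed
    have "deviation_prob P T \<theta> c n = prob {\<omega> \<in> space (P n \<theta>). \<bar>X n \<omega>\<bar> > c}"
      by (simp only: deviation_prob_def iff)
    also have "\<dots> \<le> prob ((space (P n \<theta>) - {\<omega> \<in> space (P n \<theta>). X n \<omega> \<le> c})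
        \<union> {\<omega> \<in> space (P n \<theta>). X n \<omega> \<le> - c})"
      by (intro finite_measure_mono) auto
    also have "\<dots> \<le> prob (space (P n \<theta>) - {\<omega> \<in> space (P n \<theta>). X n \<omega> \<le> c})
        + prob {\<omega> \<in> space (P n \<theta>). X n \<omega> \<le> - c}"
      by (intro measure_Un_le) auto
    also have "\<dots> = 1 - F n c + F n (- c)"
      by (simp add: Fn prob_compl)
    finally show ?thesis .
  qed
  show ?thesis
    unfolding lim[symmetric]
    by (rule Limsup_mono) (use le in \<open>auto simp: eventually_sequentially\<close>)
qed

theorem corollary2:
  fixes \<Theta> :: "real set"
    and I :: "real \<Rightarrow> real"
    and \<Omega> :: "nat \<Rightarrow> 'a measure"
    and P :: "nat \<Rightarrow> real \<Rightarrow> 'a measure"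
    and T :: "nat \<Rightarrow> 'a \<Rightarrow> real"
  assumes "open \<Theta>" and "is_interval \<Theta>"
    and "continuous_on \<Theta> I" and "\<forall>\<theta>\<in>\<Theta>. I \<theta> > 0"
    and "statistical_models \<Theta> \<Omega> P"
    and "affinity_assumption \<Theta> I P"
    and "estimator \<Theta> \<Omega> T"
  shows "(\<forall>c>0. countable {\<theta>\<in>\<Theta>.
            limsup (\<lambda>n. ereal (deviation_prob P T \<theta> c n))
              < ereal (std_normal_cdf (- c * sqrt (I \<theta>)))})
       \<and> countable {\<theta>\<in>\<Theta>. asymp_efficiency I P T \<theta> > 1}
       \<and> (\<forall>v :: real \<Rightarrow> real.
            (\<forall>\<theta>\<in>\<Theta>. v \<theta> \<ge> 0 \<and>
               weak_conv_m
                 (\<lambda>n. distr (P n \<theta>) borel (\<lambda>\<omega>. (T n \<omega> - \<theta>) * real n powr (1 / 2)))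
                 (normal_dist 0 (v \<theta>)))
            \<longrightarrow> countable {\<theta>\<in>\<Theta>. v \<theta> < 1 / I \<theta>})"
proof (intro conjI allI impI)
  let ?A = "\<lambda>c. {\<theta>\<in>\<Theta>. limsup (\<lambda>n. ereal (deviation_prob P T \<theta> c n))
              < ereal (std_normal_cdf (- c * sqrt (I \<theta>)))}"
  show A: "countable (?A c)" if "c > 0" for c
    using assms(1,3,5,6,7) that by (rule countable_small_deviation_prob)
  \<comment> \<open>Both remaining sets consist of parameters at which the deviation probabilities decay in \<open>c\<close>
    at a Gaussian rate strictly better than \<open>I \<theta>\<close>.\<close>
  have union: "countable B"
    if B: "\<And>\<theta>. \<theta> \<in> B \<Longrightarrow> \<theta> \<in> \<Theta> \<and> (\<exists>K>1. eventually (\<lambda>c::real.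
      limsup (\<lambda>n. ereal (deviation_prob P T \<theta> c n)) \<le> ereal (2 * exp (- (K * c\<^sup>2 * I \<theta> / 2)))) at_top)"
    for B
  proof (rule countable_subset)
    show "B \<subseteq> (\<Union>m::nat. ?A (real (Suc m)))"
    proof
      fix \<theta> assume "\<theta> \<in> B"
      then obtain K where \<theta>: "\<theta> \<in> \<Theta>" and K: "K > 1" and ev: "eventually (\<lambda>c::real.
          limsup (\<lambda>n. ereal (deviation_prob P T \<theta> c n)) \<le> ereal (2 * exp (- (K * c\<^sup>2 * I \<theta> / 2)))) at_top"
        using B by blast
      have "I \<theta> > 0" using \<theta> assms(4) by blast
      from ev eventually_exp_less_std_normal_cdf[OF K this]
      have "eventually (\<lambda>c::real. \<theta> \<in> ?A c) at_top"
      proof eventually_elim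
        case (elim c)
        have "ereal (2 * exp (- (K * c\<^sup>2 * I \<theta> / 2))) < ereal (std_normal_cdf (- c * sqrt (I \<theta>)))"
          using elim(2) by simp
        with elim(1) have "limsup (\<lambda>n. ereal (deviation_prob P T \<theta> c n)) < \<dots>"
          by (rule le_less_trans)
        with \<theta> show ?case by blast
      qed
      then have "eventually (\<lambda>m. \<theta> \<in> ?A (real (Suc m))) sequentially"
        by (rule eventually_compose_filterlim) 
           (rule filterlim_compose[OF filterlim_real_sequentially filterlim_Suc])
      then show "\<theta> \<in> (\<Union>m. ?A (real (Suc m)))"
        by (auto simp: eventually_sequentially)
    qed
    show "countable (\<Union>m::nat. ?A (real (Suc m)))"
      by (intro countable_UN A) auto
  qed
  show "countable {\<theta>\<in>\<Theta>. asymp_efficiency I P T \<theta> > 1}"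
  proof (rule union)
    fix \<theta> assume "\<theta> \<in> {\<theta>\<in>\<Theta>. asymp_efficiency I P T \<theta> > 1}"
    then have \<theta>: "\<theta> \<in> \<Theta>" and ae: "asymp_efficiency I P T \<theta> > ereal 1"
      by (auto simp: one_ereal_def)
    obtain K where K: "ereal 1 < ereal K" "ereal K < asymp_efficiency I P T \<theta>"
      using ereal_dense2[OF ae] by blast
    have I: "I \<theta> > 0" using \<theta> assms(4) by blast
    have "eventually (\<lambda>c::real. ereal K < liminf (\<lambda>n. neg_ln (deviation_prob P T \<theta> c n) / ereal (c\<^sup>2 * I \<theta> / 2))) at_top"
      using K(2) unfolding asymp_efficiency_def by (rule less_LiminfD)
    then have "eventually (\<lambda>c::real. limsup (\<lambda>n. ereal (deviation_prob P T \<theta> c n))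
        \<le> ereal (2 * exp (- (K * c\<^sup>2 * I \<theta> / 2)))) at_top"
      using eventually_gt_at_top[of 0]
    proof eventually_elim
      case (elim c)
      have "limsup (\<lambda>n. ereal (deviation_prob P T \<theta> c n)) \<le> ereal (exp (- (K * c\<^sup>2 * I \<theta> / 2)))"
        by (rule limsup_deviation_prob_le_exp) (use elim I in auto)
      also have "\<dots> \<le> ereal (2 * exp (- (K * c\<^sup>2 * I \<theta> / 2)))" by simp
      finally show ?case .
    qed
    then show "\<theta> \<in> \<Theta> \<and> (\<exists>K>1. eventually (\<lambda>c::real.
      limsup (\<lambda>n. ereal (deviation_prob P T \<theta> c n)) \<le> ereal (2 * exp (- (K * c\<^sup>2 * I \<theta> / 2)))) at_top)"
      using K(1) \<theta> by auto
  qed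
  fix v :: "real \<Rightarrow> real"
  assume v: "\<forall>\<theta>\<in>\<Theta>. v \<theta> \<ge> 0 \<and>
               weak_conv_m
                 (\<lambda>n. distr (P n \<theta>) borel (\<lambda>\<omega>. (T n \<omega> - \<theta>) * real n powr (1 / 2)))
                 (normal_dist 0 (v \<theta>))"
  show "countable {\<theta>\<in>\<Theta>. v \<theta> < 1 / I \<theta>}"
  proof (rule union)
    fix \<theta> assume "\<theta> \<in> {\<theta>\<in>\<Theta>. v \<theta> < 1 / I \<theta>}"
    then have \<theta>: "\<theta> \<in> \<Theta>" and lt: "v \<theta> < 1 / I \<theta>" by auto
    have I: "I \<theta> > 0" using \<theta> assms(4) by blast
    obtain w where w: "v \<theta> < w" "w < 1 / I \<theta>" using dense[OF lt] by blast
    have v0: "v \<theta> \<ge> 0" using v \<theta> by blast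
    \<comment> \<open>\<open>K\<close> is the efficiency of a normal limit with variance \<open>w\<close>.\<close>
    define K where "K = 1 / (w * I \<theta>)"
    have K: "K > 1" using w v0 I by (simp add: K_def field_simps)
    have "limsup (\<lambda>n. ereal (deviation_prob P T \<theta> c n)) \<le> ereal (2 * exp (- (K * c\<^sup>2 * I \<theta> / 2)))"
      if c: "c > 0" for c
    proof -
      note tail = normal_dist_tail_bound[OF v0 w(1) c]
      have "limsup (\<lambda>n. ereal (deviation_prob P T \<theta> c n))
          \<le> ereal (1 - cdf (normal_dist 0 (v \<theta>)) c + cdf (normal_dist 0 (v \<theta>)) (- c))"
        using v \<theta> by (intro limsup_deviation_prob_le_weak_limit[OF assms(5,7) \<theta>] tail(1,2)) blast
      also have "\<dots> \<le> ereal (2 * exp (- (c\<^sup>2 / (2 * w))))"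
        using tail(3) by simp
      also have "c\<^sup>2 / (2 * w) = K * c\<^sup>2 * I \<theta> / 2"
        using I by (simp add: K_def)
      finally show ?thesis .
    qed
    then have "eventually (\<lambda>c::real. limsup (\<lambda>n. ereal (deviation_prob P T \<theta> c n))
        \<le> ereal (2 * exp (- (K * c\<^sup>2 * I \<theta> / 2)))) at_top"
      by (intro eventually_mono[OF eventually_gt_at_top[of 0]])
    then show "\<theta> \<in> \<Theta> \<and> (\<exists>K>1. eventually (\<lambda>c::real.
      limsup (\<lambda>n. ereal (deviation_prob P T \<theta> c n)) \<le> ereal (2 * exp (- (K * c\<^sup>2 * I \<theta> / 2)))) at_top)"
      using K \<theta> by auto
  qed
qed

end
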